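(* Let $L>0$. The ten stage, fourth order, explicit strong stability preserving method SSPRK(10,4) is not strongly stable for $\frac{d}{dt}u(t)=g(u(t))$, $u(0)=u_0$, for all smooth and semibounded $g$ with $|g|_{\mathrm{Lip}}\le L$; that is, there is a smooth and semibounded $g$ with $|g|_{\mathrm{Lip}}\le L$ for which SSPRK(10,4) is not strongly stable.
   Context: ODE setting: $\mathcal{H}$ is a real vector space with semi inner product $\langle\cdot,\cdot\rangle$ and induced seminorm $\|\cdot\|$ (e.g. a real Hilbert space such as $\mathbb{R}^2$ with the Euclidean inner product), $g\colon\mathcal{H}\to\mathcal{H}$, and the autonomous ODE is $\frac{d}{dt}u(t)=g(u(t))$, $u(0)=u_0\in\mathcal{H}$. The function $g$ is semibounded if $\langle u,g(u)\rangle\le 0$ for all $u\in\mathcal{H}$. Its Lipschitz seminorm is $|g|_{\mathrm{Lip}}=\sup_{u\ne v}\|g(u)-g(v)\|/\|u-v\|$. Smooth means infinitely differentiable. "For all $g$" refers to all such spaces $\mathcal{H}$ and all such $g$ on them. Strong stability: a one-step method mapping $u_0$ to $u_+$ with step size $\Delta t$ is strongly stable for the ODE with semibounded $g$ if there is $\Delta t_{\max}>0$ (possibly depending on $g$) such that $\|u_+\|^2\le\|u_0\|^2$ for all $u_0\in\mathcal{H}$ and all $\Delta t\in(0,\Delta t_{\max}]$. The method SSPRK(10,4): one step from $u_0$ to $u_+$ is $$u_1=u_0,\qquad u_i=u_{i-1}+\frac{\Delta t}6 g(u_{i-1}),\ i\in\{2,3,4,5\},$$ $$u_6=\frac35u_0+\frac25\Big(u_5+\frac{\Delta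 t}6g(u_5)\Big),\qquad u_i=u_{i-1}+\frac{\Delta t}6 g(u_{i-1}),\ i\in\{7,8,9,10\},$$ $$u_+=\frac1{25}u_0+\frac9{25}\Big(u_5+\frac{\Delta t}6g(u_5)\Big)+\frac35\Big(u_{10}+\frac{\Delta t}6g(u_{10})\Big).$$ *)

theory Defs
  imports "HOL-Analysis.Analysis"
begin

(* Class C^n on the whole space.  The derivative is tested on fixed directions v, which keeps the
   type of f in the recursion; on a finite-dimensional domain, continuity of all the maps
   x |-> f'(x) v is the same as continuity of f' in the operator norm. *)
primrec C_diff :: "nat \<Rightarrow> ('a::euclidean_space \<Rightarrow> 'b::real_normed_vector) \<Rightarrow> bool" where
  "C_diff 0 f \<longleftrightarrow> continuous_on UNIV f"
| "C_diff (Suc n) f \<longleftrightarrow>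
     (\<forall>x. f differentiable (at x)) \<and> (\<forall>v. C_diff n (\<lambda>x. frechet_derivative f (at x) v))"

definition smooth :: "('a::euclidean_space \<Rightarrow> 'b::real_normed_vector) \<Rightarrow> bool" where
  "smooth f \<longleftrightarrow> (\<forall>n. C_diff n f)"

definition semibounded :: "('a::real_inner \<Rightarrow> 'a) \<Rightarrow> bool" where
  "semibounded g \<longleftrightarrow> (\<forall>u. u \<bullet> g u \<le> 0)"

(* Extended-valued, so that the supremum is \<infinity> if g is not Lipschitz continuous. *)
definition lip_seminorm :: "('a::real_normed_vector \<Rightarrow> 'b::real_normed_vector) \<Rightarrow> ennreal" where
  "lip_seminorm g = (SUP (u, v) \<in> {(u, v). u \<noteq> v}. ennreal (norm (g u - g v) / norm (u - v)))"

(* A one-step method Phi for u' = g(u) maps g, the step size dt and u_0 to u_+ = Phi g dt u_0. *)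
definition strongly_stable ::
    "(('a::real_normed_vector \<Rightarrow> 'a) \<Rightarrow> real \<Rightarrow> 'a \<Rightarrow> 'a) \<Rightarrow> ('a \<Rightarrow> 'a) \<Rightarrow> bool" where
  "strongly_stable \<Phi> g \<longleftrightarrow>
     (\<exists>dtmax>0. \<forall>u0. \<forall>dt\<in>{0<..dtmax}. (norm (\<Phi> g dt u0))\<^sup>2 \<le> (norm u0)\<^sup>2)"

definition ssprk_10_4 :: "('a::real_vector \<Rightarrow> 'a) \<Rightarrow> real \<Rightarrow> 'a \<Rightarrow> 'a" where
  "ssprk_10_4 g dt u0 =
    (let u1 = u0;
         u2 = u1 + (dt / 6) *\<^sub>R g u1;
         u3 = u2 + (dt / 6) *\<^sub>R g u2;
         u4 = u3 + (dt / 6) *\<^sub>R g u3;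
         u5 = u4 + (dt / 6) *\<^sub>R g u4;
         u6 = (3 / 5) *\<^sub>R u0 + (2 / 5) *\<^sub>R (u5 + (dt / 6) *\<^sub>R g u5);
         u7 = u6 + (dt / 6) *\<^sub>R g u6;
         u8 = u7 + (dt / 6) *\<^sub>R g u7;
         u9 = u8 + (dt / 6) *\<^sub>R g u8;
         u10 = u9 + (dt / 6) *\<^sub>R g u9
     in (1 / 25) *\<^sub>R u0 + (9 / 25) *\<^sub>R (u5 + (dt / 6) *\<^sub>R g u5)
        + (3 / 5) *\<^sub>R (u10 + (dt / 6) *\<^sub>R g u10))"

end

theory Submission
  imports Defs "HOL-Library.Landau_Symbols"
begin

text \<open>
  Take a field that rotates the plane, \<open>u' = \<omega>(u) J u\<close> with \<open>J (x, y) = (-y, x)\<close>.  It is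
  orthogonal to \<open>u\<close>, hence semibounded, and its flow preserves the norm.  A method of order four
  therefore changes the squared norm in one step only by \<open>C h^5 + O(h^6)\<close>, and \<open>C > 0\<close> at a single
  starting point excludes strong stability.  For constant \<open>\<omega>\<close> the change is even in \<open>h\<close>, so
  \<open>C = 0\<close>; an angular velocity that depends on the position can make \<open>C\<close> nonzero, and then its sign
  can be chosen: reflection in the first axis turns the field with \<open>\<omega> = 1 + s y\<close> into the negative
  of the field with \<open>\<omega> = 1 - s y\<close>, so that, at a starting point on that axis, replacing \<open>s\<close> by
  \<open>-s\<close> amounts to replacing \<open>h\<close> by \<open>-h\<close>.  With \<open>\<omega> = 1 - y\<close>, starting point \<open>(1, 0)\<close> and
  \<open>h = dt/6\<close>, the squared norm after one step is \<open>1 + 36 h^5 + O(h^6)\<close>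
  (\<open>ssprk_energy_increase\<close>), so it grows for all small step sizes.

  The field \<open>(1 - y) J u\<close> is quadratic and not Lipschitz continuous.  It is multiplied by a
  rational cutoff that differs from \<open>1\<close> only by \<open>O(|u - (1, 0)|^6)\<close> near the starting point.  All
  stages stay within \<open>O(h)\<close> of that point, so the cutoff does not change the terms up to \<open>h^5\<close>, and
  every stage can be computed as a polynomial in \<open>h\<close> modulo \<open>h^6\<close> (\<open>euler_step_jet\<close>, \<open>ssprk_jet\<close>).
  The damped field is smooth and has a finite Lipschitz constant (\<open>smooth_swirl\<close>,
  \<open>bounded_lipschitz_swirl\<close>).  Multiplying it by a positive constant only rescales the step size
  (\<open>ssprk_scaleR\<close>), so the Lipschitz constant can be made as small as desired.
\<close>

section \<open>Smooth functions\<close>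

lemma frechet_derivative_eqI:
  "(f has_derivative f') (at x) \<Longrightarrow> frechet_derivative f (at x) = f'"
  using frechet_derivative_at by metis

lemma C_diff_SucD: "C_diff (Suc n) f \<Longrightarrow> C_diff n f"
proof (induction n arbitrary: f)
  case 0
  then have "f differentiable_on UNIV"
    by (simp add: differentiable_on_def)
  then show ?case
    by (simp add: differentiable_imp_continuous_on)
next
  case (Suc n)
  then show ?case
    by (metis C_diff.simps(2))
qed

lemma C_diff_const: "C_diff n (\<lambda>x. c)"
  by (induction n arbitrary: c) simp_all

lemma C_diff_add:
  "C_diff n f \<Longrightarrow> C_diff n g \<Longrightarrow> C_diff n (\<lambda>x. f x + g x)"
proof (induction n arbitrary: f g)
  case 0
  then show ?case
    by (simp add: continuous_on_add)
next
  case (Suc n)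
  have "frechet_derivative (\<lambda>x. f x + g x) (at x)
      = (\<lambda>v. frechet_derivative f (at x) v + frechet_derivative g (at x) v)" for x
    using Suc.prems
    by (intro frechet_derivative_eqI has_derivative_add) (simp_all add: frechet_derivative_works[symmetric])
  with Suc show ?case
    by simp
qed

lemma C_diff_scaleR:
  fixes f :: "'a::euclidean_space \<Rightarrow> real" and g :: "'a \<Rightarrow> 'b::real_normed_vector"
  shows "C_diff n f \<Longrightarrow> C_diff n g \<Longrightarrow> C_diff n (\<lambda>x. f x *\<^sub>R g x)"
proof (induction n arbitrary: f g)
  case 0
  then show ?case
    by (simp add: continuous_on_scaleR)
next
  case (Suc n)
  have "frechet_derivative (\<lambda>x. f x *\<^sub>R g x) (at x)
      = (\<lambda>v. f x *\<^sub>R frechet_derivative g (at x) v + frechet_derivative f (at x) v *\<^sub>R g x)" for x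
    using Suc.prems
    by (intro frechet_derivative_eqI has_derivative_scaleR)
      (simp_all add: frechet_derivative_works[symmetric])
  moreover have "C_diff n (\<lambda>x. f x *\<^sub>R frechet_derivative g (at x) v
      + frechet_derivative f (at x) v *\<^sub>R g x)" for v
    using Suc.prems C_diff_SucD[OF Suc.prems(1)] C_diff_SucD[OF Suc.prems(2)]
    by (intro C_diff_add Suc.IH) simp_all
  ultimately show ?case
    using Suc.prems by (simp add: differentiable_scaleR)
qed

text \<open>The derivative of \<open>1/f\<close> is \<open>- f'/f^2\<close>, which contains \<open>1/f\<close> again but no derivative of it; so
  the induction hypothesis for \<open>1/f\<close> itself is enough.\<close>

lemma C_diff_inverse:
  fixes f :: "'a::euclidean_space \<Rightarrow> real"
  assumes "\<And>x. f x \<noteq> 0"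
  shows "C_diff n f \<Longrightarrow> C_diff n (\<lambda>x. inverse (f x))"
proof (induction n)
  case 0
  then show ?case
    using assms by (simp add: continuous_on_inverse)
next
  case (Suc n)
  have "frechet_derivative (\<lambda>x. inverse (f x)) (at x)
      = (\<lambda>v. - (inverse (f x) * frechet_derivative f (at x) v * inverse (f x)))" for x
    using Suc.prems assms
    by (intro frechet_derivative_eqI Deriv.has_derivative_inverse)
      (simp_all add: frechet_derivative_works[symmetric])
  then have eq: "frechet_derivative (\<lambda>x. inverse (f x)) (at x)
      = (\<lambda>v. (- 1) *\<^sub>R (inverse (f x) *\<^sub>R (inverse (f x) *\<^sub>R frechet_derivative f (at x) v)))" for x
    by (simp add: mult_ac)
  have "C_diff n (\<lambda>x. inverse (f x))"
    using Suc C_diff_SucD by blast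
  then have "C_diff n (\<lambda>x. (- 1) *\<^sub>R (inverse (f x) *\<^sub>R
      (inverse (f x) *\<^sub>R frechet_derivative f (at x) v)))" for v
    using Suc.prems by (intro C_diff_scaleR C_diff_const) simp_all
  then show ?case
    unfolding C_diff.simps eq using Suc.prems assms by (simp add: differentiable_inverse)
qed

lemma C_diff_bounded_linear:
  assumes "bounded_linear f"
  shows "C_diff n f"
proof (cases n)
  case 0
  then show ?thesis
    using assms by (simp add: linear_continuous_on)
next
  case (Suc m)
  have "frechet_derivative f (at x) = f" for x
    using assms by (intro frechet_derivative_eqI bounded_linear_imp_has_derivative)
  with Suc assms show ?thesis
    by (simp add: C_diff_const bounded_linear_imp_differentiable)
qed

lemma smooth_const: "smooth (\<lambda>x. c)"
  and smooth_add: "smooth f \<Longrightarrow> smooth g \<Longrightarrow> smooth (\<lambda>x. f x + g x)"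
  and smooth_scaleR: "smooth h \<Longrightarrow> smooth g \<Longrightarrow> smooth (\<lambda>x. h x *\<^sub>R g x)"
  and smooth_inverse: "smooth h \<Longrightarrow> (\<And>x. h x \<noteq> 0) \<Longrightarrow> smooth (\<lambda>x. inverse (h x))"
  and smooth_bounded_linear: "bounded_linear f \<Longrightarrow> smooth f"
  for h :: "'a::euclidean_space \<Rightarrow> real"
  by (simp_all add: smooth_def C_diff_const C_diff_add C_diff_scaleR C_diff_inverse
      C_diff_bounded_linear)

lemma smooth_diff:
  assumes "smooth f" "smooth g"
  shows "smooth (\<lambda>x. f x - g x)"
  using smooth_add[OF assms(1) smooth_scaleR[OF smooth_const[of "- 1"] assms(2)]] by simp

lemma smooth_mult:
  fixes f g :: "'a::euclidean_space \<Rightarrow> real"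
  shows "smooth f \<Longrightarrow> smooth g \<Longrightarrow> smooth (\<lambda>x. f x * g x)"
  using smooth_scaleR[of f g] by simp

lemma smooth_power:
  fixes f :: "'a::euclidean_space \<Rightarrow> real"
  shows "smooth f \<Longrightarrow> smooth (\<lambda>x. f x ^ n)"
  by (induction n) (simp_all add: smooth_const smooth_mult)

lemma smooth_inner_diff: "smooth (\<lambda>x::'a::euclidean_space. (x - c) \<bullet> b)"
  unfolding inner_diff_left
  by (intro smooth_diff smooth_const smooth_bounded_linear bounded_linear_inner_left)

lemma smooth_norm_power2: "smooth (\<lambda>x::'a::euclidean_space. (norm (x - c))\<^sup>2)"
proof -
  have sum: "smooth (\<lambda>x::'a. \<Sum>b\<in>B. ((x - c) \<bullet> b)\<^sup>2)" for B
  proof (induction B rule: infinite_finite_induct)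
    case (insert b B)
    have "smooth (\<lambda>x::'a. ((x - c) \<bullet> b)\<^sup>2 + (\<Sum>b\<in>B. ((x - c) \<bullet> b)\<^sup>2))"
      by (intro smooth_add smooth_power smooth_inner_diff insert)
    with insert.hyps show ?case
      by simp
  qed (simp_all add: smooth_const)
  have "(norm (x - c))\<^sup>2 = (\<Sum>b\<in>Basis. ((x - c) \<bullet> b)\<^sup>2)" for x :: 'a
    by (subst euclidean_inner[of "x - c" "x - c", folded power2_norm_eq_inner])
      (simp add: power2_eq_square)
  with sum show ?thesis
    by simp
qed

section \<open>Bounded Lipschitz functions\<close>

text \<open>A product of Lipschitz functions need not be Lipschitz; boundedness is what makes the class
  closed under products.\<close>

definition bounded_lipschitz :: "('a::real_normed_vector \<Rightarrow> 'b::real_normed_vector) \<Rightarrow> bool" where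
  "bounded_lipschitz f \<longleftrightarrow>
     (\<exists>K. \<forall>u v. norm (f u) \<le> K \<and> norm (f u - f v) \<le> K * norm (u - v))"

lemma bounded_lipschitzE:
  assumes "bounded_lipschitz f"
  obtains K where "K > 0" "\<And>u. norm (f u) \<le> K" "\<And>u v. norm (f u - f v) \<le> K * norm (u - v)"
proof -
  obtain K where K: "\<And>u v. norm (f u) \<le> K \<and> norm (f u - f v) \<le> K * norm (u - v)"
    using assms by (auto simp: bounded_lipschitz_def)
  have "norm (f u) \<le> \<bar>K\<bar> + 1" "norm (f u - f v) \<le> (\<bar>K\<bar> + 1) * norm (u - v)" for u v
  proof -
    show "norm (f u) \<le> \<bar>K\<bar> + 1"
      using K[of u u] by linarith
    have "K * norm (u - v) \<le> (\<bar>K\<bar> + 1) * norm (u - v)"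
      by (intro mult_right_mono) auto
    with K[of u v] show "norm (f u - f v) \<le> (\<bar>K\<bar> + 1) * norm (u - v)"
      by linarith
  qed
  then show thesis
    using that[of "\<bar>K\<bar> + 1"] by simp
qed

lemma bounded_lipschitzI:
  assumes "\<And>u. norm (f u) \<le> A" "\<And>u v. norm (f u - f v) \<le> B * norm (u - v)"
  shows "bounded_lipschitz f"
  unfolding bounded_lipschitz_def
proof (intro exI allI conjI)
  fix u v
  show "norm (f u) \<le> max A B"
    using assms(1)[of u] by linarith
  have "B * norm (u - v) \<le> max A B * norm (u - v)"
    by (intro mult_right_mono) auto
  with assms(2)[of u v] show "norm (f u - f v) \<le> max A B * norm (u - v)"
    by linarith
qed

lemma bounded_lipschitz_const: "bounded_lipschitz (\<lambda>x. c)"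
  by (rule bounded_lipschitzI[of _ "norm c" 0]) auto

lemma bounded_lipschitz_add:
  assumes "bounded_lipschitz f" "bounded_lipschitz g"
  shows "bounded_lipschitz (\<lambda>x. f x + g x)"
proof -
  from assms(1) obtain K where K: "K > 0" "\<And>u. norm (f u) \<le> K"
    "\<And>u v. norm (f u - f v) \<le> K * norm (u - v)" by (rule bounded_lipschitzE) blast
  from assms(2) obtain M where M: "M > 0" "\<And>u. norm (g u) \<le> M"
    "\<And>u v. norm (g u - g v) \<le> M * norm (u - v)" by (rule bounded_lipschitzE) blast
  show ?thesis
  proof (rule bounded_lipschitzI)
    show "norm (f u + g u) \<le> K + M" for u
      using norm_triangle_mono[OF K(2) M(2)] .
    show "norm (f u + g u - (f v + g v)) \<le> (K + M) * norm (u - v)" for u v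
      using norm_triangle_mono[OF K(3) M(3)] by (simp add: algebra_simps)
  qed
qed

lemma bounded_lipschitz_scaleR:
  assumes "bounded_lipschitz f" "bounded_lipschitz g"
  shows "bounded_lipschitz (\<lambda>x. f x *\<^sub>R g x)"
proof -
  from assms(1) obtain K where K: "K > 0" "\<And>u. norm (f u) \<le> K"
    "\<And>u v. norm (f u - f v) \<le> K * norm (u - v)" by (rule bounded_lipschitzE) blast
  from assms(2) obtain M where M: "M > 0" "\<And>u. norm (g u) \<le> M"
    "\<And>u v. norm (g u - g v) \<le> M * norm (u - v)" by (rule bounded_lipschitzE) blast
  show ?thesis
  proof (rule bounded_lipschitzI)
    show "norm (f u *\<^sub>R g u) \<le> K * M" for u
      unfolding norm_scaleR using K M by (intro mult_mono) (auto intro: less_imp_le)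
    show "norm (f u *\<^sub>R g u - f v *\<^sub>R g v) \<le> (2 * K * M) * norm (u - v)" for u v
    proof -
      have "f u *\<^sub>R g u - f v *\<^sub>R g v = f u *\<^sub>R (g u - g v) + (f u - f v) *\<^sub>R g v"
        by (simp add: algebra_simps)
      also have "norm \<dots> \<le> K * (M * norm (u - v)) + (K * norm (u - v)) * M"
      proof (rule norm_triangle_mono)
        show "norm (f u *\<^sub>R (g u - g v)) \<le> K * (M * norm (u - v))"
          unfolding norm_scaleR using K M by (intro mult_mono) (auto intro: less_imp_le)
        show "norm ((f u - f v) *\<^sub>R g v) \<le> (K * norm (u - v)) * M"
          unfolding norm_scaleR using K M by (intro mult_mono) (auto intro: less_imp_le)
      qed
      finally show ?thesis
        by (simp add: algebra_simps)
    qed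
  qed
qed

lemma bounded_lipschitz_bounded_linear:
  assumes "bounded_linear T" "bounded_lipschitz f"
  shows "bounded_lipschitz (\<lambda>x. T (f x))"
proof -
  interpret T: bounded_linear T by fact
  obtain C where C: "C > 0" "\<And>x. norm (T x) \<le> norm x * C"
    using T.pos_bounded by blast
  from assms(2) obtain K where K: "K > 0" "\<And>u. norm (f u) \<le> K"
    "\<And>u v. norm (f u - f v) \<le> K * norm (u - v)" by (rule bounded_lipschitzE) blast
  show ?thesis
  proof (rule bounded_lipschitzI)
    show "norm (T (f u)) \<le> K * C" for u
      using C(2)[of "f u"] mult_right_mono[OF K(2)[of u], of C] C(1) by linarith
    show "norm (T (f u) - T (f v)) \<le> (C * K) * norm (u - v)" for u v
      using order_trans[OF C(2)[of "f u - f v"] mult_right_mono[OF K(3)[of u v], of C]] C(1)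
      by (simp add: T.diff mult_ac)
  qed
qed

lemma bounded_lipschitz_power:
  fixes f :: "'a::real_normed_vector \<Rightarrow> real"
  assumes "bounded_lipschitz f"
  shows "bounded_lipschitz (\<lambda>x. f x ^ n)"
proof (induction n)
  case (Suc n)
  show ?case
    using bounded_lipschitz_scaleR[OF assms Suc] by simp
qed (simp add: bounded_lipschitz_const)

lemma lip_seminorm_le:
  assumes "\<And>u v. norm (f u - f v) \<le> K * norm (u - v)"
  shows "lip_seminorm f \<le> ennreal K"
  unfolding lip_seminorm_def
proof (rule SUP_least, clarify)
  fix u v :: 'a assume "u \<noteq> v"
  then show "ennreal (norm (f u - f v) / norm (u - v)) \<le> ennreal K"
    using assms[of u v] by (intro ennreal_leI) (simp add: divide_le_eq)
qed

section \<open>A rational bump\<close>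

definition bump :: "'a::euclidean_space \<Rightarrow> 'a \<Rightarrow> real" where
  "bump c u = inverse (1 + (norm (u - c))\<^sup>2)"

lemma bump_pos: "bump c u > 0"
  and bump_le_1: "bump c u \<le> 1"
  by (simp_all add: bump_def add_pos_nonneg inverse_le_1_iff)

lemma smooth_bump: "smooth (bump c)"
proof -
  have "1 + (norm (u - c))\<^sup>2 \<noteq> 0" for u
    by (metis add_pos_nonneg less_irrefl zero_le_power2 zero_less_one)
  then show ?thesis
    unfolding bump_def[abs_def]
    by (intro smooth_inverse smooth_add smooth_const smooth_norm_power2)
qed

text \<open>This is \<open>2 r \<le> 1 + r^2\<close>: one factor \<open>bump c\<close> compensates linear growth.\<close>

lemma bump_norm_le: "bump c u * norm (u - c) \<le> 1 / 2"
proof -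
  have "0 \<le> (norm (u - c) - 1)\<^sup>2" by simp
  then have "2 * norm (u - c) \<le> 1 + (norm (u - c))\<^sup>2"
    by (simp add: power2_diff)
  moreover have "1 + (norm (u - c))\<^sup>2 > 0"
    by (simp add: add_pos_nonneg)
  ultimately show ?thesis
    by (simp add: bump_def field_simps)
qed

lemma bump_diff_le:
  "\<bar>bump c u - bump c v\<bar> \<le> bump c u * bump c v * ((norm (u - c) + norm (v - c)) * norm (u - v))"
proof -
  have nz: "1 + (norm (w - c))\<^sup>2 \<noteq> 0" for w
    by (metis add_pos_nonneg less_irrefl zero_le_power2 zero_less_one)
  have "bump c u - bump c v
      = bump c u * bump c v * ((norm (v - c) + norm (u - c)) * (norm (v - c) - norm (u - c)))"
    unfolding bump_def using nz[of u] nz[of v] by (simp add: field_simps power2_eq_square)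
  then have "\<bar>bump c u - bump c v\<bar>
      = bump c u * bump c v * ((norm (v - c) + norm (u - c)) * \<bar>norm (v - c) - norm (u - c)\<bar>)"
    using bump_pos[of c u] bump_pos[of c v] by (simp add: abs_mult)
  also have "\<bar>norm (v - c) - norm (u - c)\<bar> \<le> norm (u - v)"
    using norm_triangle_ineq3[of "v - c" "u - c"] by (simp add: norm_minus_commute)
  finally show ?thesis
    using bump_pos[of c u] bump_pos[of c v] by (simp add: mult_left_mono add.commute)
qed

lemma bounded_lipschitz_bump: "bounded_lipschitz (bump c)"
proof (rule bounded_lipschitzI)
  show "norm (bump c u) \<le> 1" for u
    using bump_pos[of c u] bump_le_1[of c u] by simp
  show "norm (bump c u - bump c v) \<le> 1 * norm (u - v)" for u v
  proof -
    have "bump c v * (bump c u * norm (u - c)) \<le> 1 * (1 / 2)"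
      using bump_pos[of c v] bump_pos[of c u]
      by (intro mult_mono bump_le_1 bump_norm_le) (auto intro: less_imp_le)
    moreover have "bump c u * (bump c v * norm (v - c)) \<le> 1 * (1 / 2)"
      using bump_pos[of c v] bump_pos[of c u]
      by (intro mult_mono bump_le_1 bump_norm_le) (auto intro: less_imp_le)
    ultimately have "bump c u * bump c v * (norm (u - c) + norm (v - c)) \<le> 1"
      by (simp add: algebra_simps)
    from mult_right_mono[OF this norm_ge_zero[of "u - v"]] bump_diff_le[of c u v]
    show ?thesis
      by (simp add: mult_ac)
  qed
qed

lemma bounded_lipschitz_bump_scaleR: "bounded_lipschitz (\<lambda>u. bump c u *\<^sub>R u)"
proof -
  have "bounded_lipschitz (\<lambda>u. bump c u *\<^sub>R (u - c))"
  proof (rule bounded_lipschitzI)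
    show "norm (bump c u *\<^sub>R (u - c)) \<le> 1" for u
      using bump_pos[of c u] bump_norm_le[of c u] by simp
    show "norm (bump c u *\<^sub>R (u - c) - bump c v *\<^sub>R (v - c)) \<le> 3 * norm (u - v)" for u v
    proof -
      \<comment> \<open>With \<open>s = bump c u\<close>, \<open>t = bump c v\<close>, \<open>a = norm (u - c)\<close>, \<open>b = norm (v - c)\<close> the left-hand
        side is \<open>(s a) (t b) + s (t b^2)\<close>.\<close>
      have bound: "bump c u * bump c v * (norm (u - c) + norm (v - c)) * norm (v - c) \<le> 2"
      proof -
        have "(bump c u * norm (u - c)) * (bump c v * norm (v - c)) \<le> (1 / 2) * (1 / 2)"
          using bump_pos[of c v] bump_pos[of c u]
          by (intro mult_mono bump_norm_le) (auto intro: less_imp_le)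
        moreover have "bump c v * (norm (v - c))\<^sup>2 \<le> 1"
          by (simp add: bump_def field_simps add_pos_nonneg)
        then have "bump c u * (bump c v * (norm (v - c))\<^sup>2) \<le> 1 * 1"
          using bump_pos[of c v] bump_pos[of c u]
          by (intro mult_mono bump_le_1) (auto intro: less_imp_le)
        ultimately show ?thesis
          by (simp add: algebra_simps power2_eq_square)
      qed
      have "bump c u *\<^sub>R (u - c) - bump c v *\<^sub>R (v - c)
          = bump c u *\<^sub>R (u - v) + (bump c u - bump c v) *\<^sub>R (v - c)"
        by (simp add: algebra_simps)
      also have "norm \<dots> \<le> 1 * norm (u - v) + 2 * norm (u - v)"
      proof (rule norm_triangle_mono)
        show "norm (bump c u *\<^sub>R (u - v)) \<le> 1 * norm (u - v)"
          unfolding norm_scaleR using bump_pos[of c u] bump_le_1[of c u]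
          by (intro mult_right_mono) auto
        have "norm ((bump c u - bump c v) *\<^sub>R (v - c))
            \<le> bump c u * bump c v * ((norm (u - c) + norm (v - c)) * norm (u - v)) * norm (v - c)"
          unfolding norm_scaleR by (intro mult_right_mono bump_diff_le) auto
        also have "\<dots> \<le> 2 * norm (u - v)"
          using mult_right_mono[OF bound norm_ge_zero[of "u - v"]] by (simp add: mult_ac)
        finally show "norm ((bump c u - bump c v) *\<^sub>R (v - c)) \<le> 2 * norm (u - v)" .
      qed
      finally show ?thesis
        by simp
    qed
  qed
  from bounded_lipschitz_add[OF this
      bounded_lipschitz_scaleR[OF bounded_lipschitz_bump[of c] bounded_lipschitz_const[of c]]]
  show ?thesis
    by (simp add: algebra_simps)
qed

text \<open>The function \<open>1 - (1 - s^2)^3\<close> with \<open>s = bump c u\<close> serves as a cutoff for two reasons.  It is flat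
  at \<open>c\<close>: since \<open>1 - s^2 = O(|u - c|^2)\<close>, its cube is of order six.  And it equals
  \<open>s^2 (3 - 3 s^2 + s^4)\<close>, so it contains two factors \<open>s\<close> and can absorb a quadratic polynomial.\<close>

lemma bump_flat: "\<bar>1 - (1 - (1 - (bump c u)\<^sup>2) ^ 3)\<bar> \<le> 8 * norm (u - c) ^ 6"
proof -
  define r where "r = (norm (u - c))\<^sup>2"
  have r: "r \<ge> 0" "bump c u = 1 / (1 + r)"
    by (simp_all add: r_def bump_def divide_inverse)
  have "1 - (bump c u)\<^sup>2 = r * (2 + r) / (1 + r)\<^sup>2"
  proof -
    have "(1 + r)\<^sup>2 - 1 = r * (2 + r)"
      by (simp add: power2_eq_square algebra_simps)
    then show ?thesis
      using r by (simp add: power_divide diff_divide_distrib flip: \<open>_ = r * (2 + r)\<close>)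
  qed
  also have "\<dots> \<le> 2 * r"
  proof -
    have "r * (2 + r) \<le> 2 * r * (1 + r)\<^sup>2"
      using r(1) by (simp add: power2_eq_square algebra_simps)
    then show ?thesis
      using r(1) by (simp add: divide_le_eq)
  qed
  finally have "1 - (bump c u)\<^sup>2 \<le> 2 * r" .
  moreover have "0 \<le> 1 - (bump c u)\<^sup>2"
    using bump_pos[of c u] bump_le_1[of c u] by (simp add: power_le_one)
  ultimately have "(1 - (bump c u)\<^sup>2) ^ 3 \<le> (2 * r) ^ 3" "0 \<le> (1 - (bump c u)\<^sup>2) ^ 3"
    by (blast intro: power_mono zero_le_power)+
  then show ?thesis
    by (simp add: r_def power_mult_distrib flip: power_mult)
qed

section \<open>Taylor polynomials at zero\<close>

text \<open>The degree of \<open>p\<close> is not restricted: products are formed with all their terms, and the terms of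
  order \<open>n\<close> and higher are dropped only where \<open>has_jet_cong\<close> is applied.  The limit is one-sided
  because step sizes are positive.\<close>

definition has_jet :: "nat \<Rightarrow> (real \<Rightarrow> real) \<Rightarrow> real poly \<Rightarrow> bool" where
  "has_jet n f p \<longleftrightarrow> (\<lambda>h. f h - poly p h) \<in> O[at_right 0](\<lambda>h. h ^ n)"

lemma poly_bigo_1: "poly p \<in> O[at_right (0::real)](\<lambda>_. 1)"
proof -
  have "(poly p \<longlongrightarrow> poly p 0) (at_right 0)"
    by (intro tendsto_intros)
  then show ?thesis
    by (intro bigoI_tendsto[of _ _ "poly p 0"]) simp_all
qed

lemma power_bigo_at_right_0:
  assumes "n \<le> m"
  shows "(\<lambda>h::real. h ^ m) \<in> O[at_right 0](\<lambda>h. h ^ n)"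
proof -
  have "(\<lambda>h::real. h ^ n * h ^ (m - n)) \<in> O[at_right 0](\<lambda>h. h ^ n * 1)"
    using poly_bigo_1[of "monom 1 (m - n)"]
    by (intro landau_o.big_mult) (simp_all add: poly_monom[abs_def])
  with assms show ?thesis
    by (simp flip: power_add)
qed

lemma has_jet_bigo_1:
  assumes "has_jet n f p"
  shows "f \<in> O[at_right 0](\<lambda>_. 1)"
proof -
  have "(\<lambda>h. f h - poly p h) \<in> O[at_right 0](\<lambda>h. h ^ 0)"
    using assms power_bigo_at_right_0[of 0 n] unfolding has_jet_def
    by (rule landau_o.big_trans) simp
  from sum_in_bigo(1)[OF this, of "poly p"] poly_bigo_1[of p] show ?thesis
    by simp
qed

lemma has_jet_const: "has_jet n (\<lambda>h. c) [:c:]"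
  and has_jet_ident: "has_jet n (\<lambda>h. h) [:0, 1:]"
  by (simp_all add: has_jet_def)

lemma has_jet_add: "has_jet n f p \<Longrightarrow> has_jet n g q \<Longrightarrow> has_jet n (\<lambda>h. f h + g h) (p + q)"
  unfolding has_jet_def by (drule (1) sum_in_bigo(1)) (simp add: algebra_simps)

lemma has_jet_diff: "has_jet n f p \<Longrightarrow> has_jet n g q \<Longrightarrow> has_jet n (\<lambda>h. f h - g h) (p - q)"
  unfolding has_jet_def by (drule (1) sum_in_bigo(2)) (simp add: algebra_simps)

lemma has_jet_mult:
  assumes "has_jet n f p" "has_jet n g q"
  shows "has_jet n (\<lambda>h. f h * g h) (p * q)"
proof -
  have "(\<lambda>h. (f h - poly p h) * g h) \<in> O[at_right 0](\<lambda>h. h ^ n * 1)"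
    using assms(1) has_jet_bigo_1[OF assms(2)] unfolding has_jet_def by (rule landau_o.big_mult)
  moreover have "(\<lambda>h. poly p h * (g h - poly q h)) \<in> O[at_right 0](\<lambda>h. 1 * h ^ n)"
    using poly_bigo_1 assms(2) unfolding has_jet_def by (rule landau_o.big_mult)
  ultimately have "(\<lambda>h. (f h - poly p h) * g h + poly p h * (g h - poly q h)) \<in> O[at_right 0](\<lambda>h. h ^ n)"
    by (intro sum_in_bigo(1)) simp_all
  then show ?thesis
    by (simp add: has_jet_def algebra_simps)
qed

text \<open>Both kinds of error of order \<open>n\<close> at once: a change of the function, and a change of the
  polynomial modulo \<open>X^n\<close>.\<close>

lemma has_jet_cong:
  assumes "has_jet n f p" "(\<lambda>h. g h - f h) \<in> O[at_right 0](\<lambda>h. h ^ n)"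
    "monom 1 n dvd p - q"
  shows "has_jet n g q"
proof -
  obtain r where r: "p - q = monom 1 n * r"
    using assms(3) by (rule dvdE)
  have "(\<lambda>h. h ^ n * poly r h) \<in> O[at_right 0](\<lambda>h. h ^ n * 1)"
    by (intro landau_o.big_mult poly_bigo_1) simp
  moreover have "h ^ n * poly r h = poly p h - poly q h" for h
    using arg_cong[OF r, of "\<lambda>p. poly p h"] by (simp add: poly_monom)
  ultimately have "(\<lambda>h. poly p h - poly q h) \<in> O[at_right 0](\<lambda>h. h ^ n)"
    by simp
  with assms(1,2) have "(\<lambda>h. (g h - f h) + ((f h - poly p h) + (poly p h - poly q h))) \<in> O[at_right 0](\<lambda>h. h ^ n)"
    unfolding has_jet_def by (intro sum_in_bigo(1))
  then show ?thesis
    by (simp add: has_jet_def)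
qed

lemma has_jet_minus_const_bigo:
  assumes "has_jet n f p" "n > 0" "coeff p 0 = c"
  shows "(\<lambda>h. f h - c) \<in> O[at_right 0](\<lambda>h. h)"
proof -
  have "has_jet 1 f p"
    using assms(1) power_bigo_at_right_0[of 1 n] \<open>n > 0\<close> unfolding has_jet_def
    by (auto elim!: landau_o.big_trans)
  moreover have "monom 1 1 dvd p - [:c:]"
    using assms(3) unfolding monom_1_dvd_iff' by simp
  ultimately have "has_jet 1 f [:c:]"
    using has_jet_cong[of 1 f p f "[:c:]"] by simp
  then show ?thesis
    by (simp add: has_jet_def)
qed

lemma has_jet_eventually_pos:
  assumes "has_jet (Suc n) f (monom c n)" "c > 0"
  shows "\<forall>\<^sub>F h in at_right 0. f h > 0"
proof -
  obtain K where K: "K > 0" "\<forall>\<^sub>F h in at_right 0. norm (f h - poly (monom c n) h) \<le> K * norm (h ^ Suc n)"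
    using assms(1) unfolding has_jet_def by (rule landau_o.bigE)
  have "\<forall>\<^sub>F h in at_right (0::real). h < c / K"
    using K assms(2) by (intro eventually_at_right_less eventually_at_rightI[of 0 "c/K"]) simp_all
  moreover have "\<forall>\<^sub>F h in at_right (0::real). h > 0"
    by (simp add: eventually_at_right_less)
  ultimately show ?thesis
    using K(2)
  proof eventually_elim
    case (elim h)
    have "(K * h) * h ^ n < c * h ^ n"
      using elim K(1) by (intro mult_strict_right_mono) (simp_all add: field_simps)
    moreover have "\<bar>f h - c * h ^ n\<bar> \<le> (K * h) * h ^ n"
      using elim by (simp add: poly_monom)
    ultimately show ?case
      by linarith
  qed
qed

section \<open>The vector field and the energy of one step\<close>

definition rot :: "real^2 \<Rightarrow> real^2" where
  "rot u = vector [- (u $ 2), u $ 1]"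

definition cutoff :: "real^2 \<Rightarrow> real" where
  "cutoff u = 1 - (1 - (bump (axis 1 1) u)\<^sup>2) ^ 3"

text \<open>Rotation about the origin with angular velocity \<open>1 - y\<close>, damped away from \<open>(1, 0) = axis 1 1\<close>.\<close>

definition swirl :: "real^2 \<Rightarrow> real^2" where
  "swirl u = (cutoff u * (1 - u $ 2)) *\<^sub>R rot u"

lemma rot_nth [simp]: "rot u $ 1 = - (u $ 2)" "rot u $ 2 = u $ 1"
  by (simp_all add: rot_def)

lemma bounded_linear_rot: "bounded_linear rot"
  by (intro linear_conv_bounded_linear[THEN iffD1] linearI)
    (simp_all add: vec_eq_iff forall_2)

lemma semibounded_swirl: "semibounded swirl"
  by (simp add: semibounded_def swirl_def inner_vec_def sum_2)

lemma smooth_swirl: "smooth swirl"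
  unfolding swirl_def[abs_def] cutoff_def
  by (intro smooth_scaleR smooth_mult smooth_diff smooth_power smooth_const
      smooth_bump smooth_bounded_linear bounded_linear_rot bounded_linear_vec_nth)

text \<open>The cutoff contains two factors \<open>s = bump (1, 0) u\<close>.  Giving one of them to \<open>1 - y\<close> and the other
  to \<open>J u\<close> writes the field as a product of bounded Lipschitz functions.\<close>

lemma bounded_lipschitz_swirl: "bounded_lipschitz swirl"
proof -
  let ?s = "bump (axis 1 1 :: real^2)"
  have eq: "swirl = (\<lambda>u. (3 + (- 3) *\<^sub>R ?s u ^ 2 + ?s u ^ 4) *\<^sub>R
      (?s u + - ((?s u *\<^sub>R u) $ 2)) *\<^sub>R rot (?s u *\<^sub>R u))"
  proof
    fix u
    have "1 - (1 - (?s u)\<^sup>2) ^ 3 = (3 + (- 3) *\<^sub>R ?s u ^ 2 + ?s u ^ 4) * (?s u * ?s u)"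
      by (simp add: power_numeral_reduce algebra_simps)
    then have "cutoff u * (1 - u $ 2)
        = (3 + (- 3) *\<^sub>R ?s u ^ 2 + ?s u ^ 4) * (?s u + - ((?s u *\<^sub>R u) $ 2)) * ?s u"
      by (simp only: cutoff_def) (simp add: algebra_simps)
    then show "swirl u = (3 + (- 3) *\<^sub>R ?s u ^ 2 + ?s u ^ 4) *\<^sub>R
      (?s u + - ((?s u *\<^sub>R u) $ 2)) *\<^sub>R rot (?s u *\<^sub>R u)"
      by (simp add: swirl_def linear_scale[OF bounded_linear.linear[OF bounded_linear_rot]])
  qed
  have rot: "bounded_lipschitz (\<lambda>u. rot (?s u *\<^sub>R u))"
    by (rule bounded_lipschitz_bounded_linear[OF bounded_linear_rot bounded_lipschitz_bump_scaleR])
  have nth: "bounded_lipschitz (\<lambda>u. - ((?s u *\<^sub>R u) $ 2))"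
    by (rule bounded_lipschitz_bounded_linear[OF bounded_linear_minus[OF bounded_linear_vec_nth]
          bounded_lipschitz_bump_scaleR])
  show ?thesis
    unfolding eq
    by (intro bounded_lipschitz_scaleR bounded_lipschitz_add rot nth bounded_lipschitz_const
        bounded_lipschitz_power bounded_lipschitz_bump)
qed

definition stage_jet :: "(real \<Rightarrow> real^2) \<Rightarrow> real poly \<Rightarrow> real poly \<Rightarrow> bool" where
  "stage_jet u p q \<longleftrightarrow> has_jet 6 (\<lambda>h. u h $ 1) p \<and> has_jet 6 (\<lambda>h. u h $ 2) q"

lemma cutoff_bigo:
  assumes "stage_jet u p q" "coeff p 0 = 1" "coeff q 0 = 0"
  shows "(\<lambda>h. cutoff (u h) - 1) \<in> O[at_right 0](\<lambda>h. h ^ 6)"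
proof -
  have "(\<lambda>h. u h $ 1 - 1) \<in> O[at_right 0](\<lambda>h. h)" "(\<lambda>h. u h $ 2) \<in> O[at_right 0](\<lambda>h. h)"
    using has_jet_minus_const_bigo[of 6 "\<lambda>h. u h $ 1" p 1]
      has_jet_minus_const_bigo[of 6 "\<lambda>h. u h $ 2" q 0] assms by (simp_all add: stage_jet_def)
  then have "(\<lambda>h. \<bar>u h $ 1 - 1\<bar> + \<bar>u h $ 2\<bar>) \<in> O[at_right 0](\<lambda>h. h)"
    by (intro sum_in_bigo) simp_all
  moreover have "norm (u h - axis 1 1) \<le> \<bar>u h $ 1 - 1\<bar> + \<bar>u h $ 2\<bar>" for h
    using norm_le_l1_cart[of "u h - axis 1 1"] by (simp add: sum_2 axis_def)
  then have "(\<lambda>h. norm (u h - axis 1 1)) \<in> O[at_right 0](\<lambda>h. \<bar>u h $ 1 - 1\<bar> + \<bar>u h $ 2\<bar>)"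
    by (intro bigoI[of _ 1] always_eventually) simp
  ultimately have "(\<lambda>h. norm (u h - axis 1 1)) \<in> O[at_right 0](\<lambda>h. h)"
    by (rule landau_o.big_trans[rotated])
  then have "(\<lambda>h. 8 * norm (u h - axis 1 1) ^ 6) \<in> O[at_right 0](\<lambda>h. h ^ 6)"
    by (simp add: landau_o.big_power)
  moreover have "\<bar>cutoff (u h) - 1\<bar> \<le> 8 * norm (u h - axis 1 1) ^ 6" for h
    using bump_flat[of "axis 1 1" "u h"] by (simp add: cutoff_def abs_minus_commute)
  then have "(\<lambda>h. cutoff (u h) - 1) \<in> O[at_right 0](\<lambda>h. 8 * norm (u h - axis 1 1) ^ 6)"
    by (intro bigoI[of _ 1] always_eventually) simp
  ultimately show ?thesis
    by (rule landau_o.big_trans[rotated])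
qed

text \<open>One Euler substep, computed as if the cutoff were equal to \<open>1\<close>: the hypotheses are the two
  components of the step for the field \<open>(1 - y) (-y, x)\<close>, read modulo \<open>h^6\<close>.  The constant terms of
  \<open>p\<close> and \<open>q\<close> say that the stage tends to \<open>(1, 0)\<close>, where the cutoff is flat.\<close>

lemma euler_step_jet:
  assumes u: "stage_jet u p q" and "coeff p 0 = 1" "coeff q 0 = 0"
    and p': "monom 1 6 dvd p - [:0, 1:] * (1 - q) * q - p'"
    and q': "monom 1 6 dvd q + [:0, 1:] * (1 - q) * p - q'"
  shows "stage_jet (\<lambda>h. u h + h *\<^sub>R swirl (u h)) p' q'"
proof -
  have one: "has_jet 6 (\<lambda>h. 1) 1"
    using has_jet_const[of 6 1] by (simp add: one_pCons)
  have p: "has_jet 6 (\<lambda>h. u h $ 1) p" and q: "has_jet 6 (\<lambda>h. u h $ 2) q"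
    using u by (simp_all add: stage_jet_def)
  have c: "(\<lambda>h. cutoff (u h) - 1) \<in> O[at_right 0](\<lambda>h. h ^ 6)"
    using assms(1-3) by (rule cutoff_bigo)
  note coef = has_jet_mult[OF has_jet_ident has_jet_diff[OF one q]]
  have err: "(\<lambda>h. (cutoff (u h) - 1) * (h * (1 - u h $ 2) * f h)) \<in> O[at_right 0](\<lambda>h. h ^ 6)"
    if "has_jet 6 f r" for f r
    using landau_o.big_mult[OF c has_jet_bigo_1[OF has_jet_mult[OF coef that]]] by simp
  have "has_jet 6 (\<lambda>h. (u h + h *\<^sub>R swirl (u h)) $ 1) p'"
    using has_jet_diff[OF p has_jet_mult[OF coef q]] _ p'
  proof (rule has_jet_cong)
    show "(\<lambda>h. (u h + h *\<^sub>R swirl (u h)) $ 1 - (u h $ 1 - h * (1 - u h $ 2) * u h $ 2))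
        \<in> O[at_right 0](\<lambda>h. h ^ 6)"
      using landau_o.big.uminus_in_iff[THEN iffD2, OF err[OF q]] by (simp add: swirl_def algebra_simps)
  qed
  moreover have "has_jet 6 (\<lambda>h. (u h + h *\<^sub>R swirl (u h)) $ 2) q'"
    using has_jet_add[OF q has_jet_mult[OF coef p]] _ q'
  proof (rule has_jet_cong)
    show "(\<lambda>h. (u h + h *\<^sub>R swirl (u h)) $ 2 - (u h $ 2 + h * (1 - u h $ 2) * u h $ 1))
        \<in> O[at_right 0](\<lambda>h. h ^ 6)"
      using err[OF p] by (simp add: swirl_def algebra_simps)
  qed
  ultimately show ?thesis
    by (simp add: stage_jet_def)
qed

lemma stage_jet_scaleR:
  assumes "stage_jet u p q"
  shows "stage_jet (\<lambda>h. a *\<^sub>R u h) (smult a p) (smult a q)"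
  using assms has_jet_mult[OF has_jet_const[of 6 a], of "\<lambda>h. u h $ 1" p]
    has_jet_mult[OF has_jet_const[of 6 a], of "\<lambda>h. u h $ 2" q]
  by (simp add: stage_jet_def)

lemma stage_jet_add:
  "stage_jet u p q \<Longrightarrow> stage_jet v p' q' \<Longrightarrow> stage_jet (\<lambda>h. u h + v h) (p + p') (q + q')"
  by (simp add: stage_jet_def has_jet_add)

lemma coeff_pCons_numeral: "coeff (pCons a p) (numeral n) = coeff p (pred_numeral n)"
  by (simp add: numeral_eq_Suc)

lemma all_less_6: "(\<forall>k<6. P k) \<longleftrightarrow> P (0::nat) \<and> P 1 \<and> P 2 \<and> P 3 \<and> P 4 \<and> P 5"
  by (simp add: numeral_eq_Suc All_less_Suc conj_ac)

text \<open>The method consists of Euler substeps with step \<open>h = dt/6\<close> and two linear combinations.  Starting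
  from \<open>(1, 0)\<close>, all stages turn out to have integer coefficients modulo \<open>h^6\<close>.\<close>

lemma ssprk_jet:
  "stage_jet (\<lambda>h. ssprk_10_4 swirl (6 * h) (axis 1 1))
     [:1, 0, -18, 108, -324, 18:] [:0, 6, -18, 0, 324, -1926:]"
proof -
  define E where "E = (\<lambda>u h. u h + h *\<^sub>R swirl (u h))"
  have E: "stage_jet (E u) p' q'"
    if "stage_jet u p q" "coeff p 0 = 1" "coeff q 0 = 0"
      "\<forall>k<6. coeff (p - [:0, 1:] * (1 - q) * q - p') k = 0"
      "\<forall>k<6. coeff (q + [:0, 1:] * (1 - q) * p - q') k = 0" for u p q p' q'
    using euler_step_jet[OF that(1-3), of p' q'] that(4,5) by (simp add: E_def monom_1_dvd_iff')
  note eval = coeff_pCons_numeral all_less_6 one_pCons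
  define u1 :: "real \<Rightarrow> real^2" where "u1 = (\<lambda>h. axis 1 1)"
  define u6 where "u6 = (\<lambda>h. (3 / 5) *\<^sub>R u1 h + (2 / 5) *\<^sub>R E (E (E (E (E u1)))) h)"
  have s1: "stage_jet u1 [:1:] [:0:]"
    using has_jet_const[of 6 1] has_jet_const[of 6 0]
    by (simp add: stage_jet_def u1_def axis_def)
  have s2: "stage_jet (E u1) [:1:] [:0, 1:]"
    using s1 by (rule E) (simp_all add: eval)
  have s3: "stage_jet (E (E u1)) [:1, 0, -1, 1:] [:0, 2, -1:]"
    using s2 by (rule E) (simp_all add: eval)
  have s4: "stage_jet (E (E (E u1))) [:1, 0, -3, 6, -4, 1:] [:0, 3, -3, 0, 3, -3:]"
    using s3 by (rule E) (simp_all add: eval)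
  have s5: "stage_jet (E (E (E (E u1)))) [:1, 0, -6, 18, -22, 7:] [:0, 4, -6, 0, 18, -37:]"
    using s4 by (rule E) (simp_all add: eval)
  have s5_euler: "stage_jet (E (E (E (E (E u1))))) [:1, 0, -10, 40, -70, 25:] [:0, 5, -10, 0, 60, -185:]"
    using s5 by (rule E) (simp_all add: eval)
  have s6: "stage_jet u6 [:1, 0, -4, 16, -28, 10:] [:0, 2, -4, 0, 24, -74:]"
    using stage_jet_add[OF stage_jet_scaleR[OF s1, of "3 / 5"] stage_jet_scaleR[OF s5_euler, of "2 / 5"]]
    by (simp add: u6_def)
  have s7: "stage_jet (E u6) [:1, 0, -6, 24, -44, 2:] [:0, 3, -6, 0, 48, -174:]"
    using s6 by (rule E) (simp_all add: eval)
  have s8: "stage_jet (E (E u6)) [:1, 0, -9, 39, -80, -10:] [:0, 4, -9, 0, 90, -374:]"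
    using s7 by (rule E) (simp_all add: eval)
  have s9: "stage_jet (E (E (E u6))) [:1, 0, -13, 64, -152, -19:] [:0, 5, -13, 0, 165, -781:]"
    using s8 by (rule E) (simp_all add: eval)
  have s10: "stage_jet (E (E (E (E u6)))) [:1, 0, -18, 102, -282, -15:] [:0, 6, -18, 0, 294, -1587:]"
    using s9 by (rule E) (simp_all add: eval)
  have s11: "stage_jet (E (E (E (E (E u6))))) [:1, 0, -24, 156, -498, 15:] [:0, 7, -24, 0, 504, -3099:]"
    using s10 by (rule E) (simp_all add: eval)
  have "(\<lambda>h. ssprk_10_4 swirl (6 * h) (axis 1 1))
      = (\<lambda>h. ((1 / 25) *\<^sub>R u1 h + (9 / 25) *\<^sub>R E (E (E (E (E u1)))) h) + (3 / 5) *\<^sub>R E (E (E (E (E u6)))) h)"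
    by (simp add: ssprk_10_4_def Let_def u6_def u1_def E_def)
  then show ?thesis
    using stage_jet_add[OF stage_jet_add[OF stage_jet_scaleR[OF s1, of "1 / 25"]
      stage_jet_scaleR[OF s5_euler, of "9 / 25"]] stage_jet_scaleR[OF s11, of "3 / 5"]]
    by simp
qed

text \<open>The coefficients of \<open>h, ..., h^4\<close> in the squared norm cancel, as order four requires for a
  norm-preserving flow, and that of \<open>h^5\<close> is \<open>36\<close>.\<close>

lemma ssprk_energy_increase:
  "\<forall>\<^sub>F h in at_right 0. (norm (ssprk_10_4 swirl (6 * h) (axis 1 1)))\<^sup>2 > 1"
proof -
  let ?u = "\<lambda>h. ssprk_10_4 swirl (6 * h) (axis 1 1)"
  let ?p = "[:1, 0, -18, 108, -324, 18:] :: real poly"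
  let ?q = "[:0, 6, -18, 0, 324, -1926:] :: real poly"
  have x: "has_jet 6 (\<lambda>h. ?u h $ 1) ?p" and y: "has_jet 6 (\<lambda>h. ?u h $ 2) ?q"
    using ssprk_jet by (simp_all add: stage_jet_def)
  have one: "has_jet 6 (\<lambda>h. 1) 1"
    using has_jet_const[of 6 1] by (simp add: one_pCons)
  have "has_jet 6 (\<lambda>h. (norm (?u h))\<^sup>2 - 1) (monom 36 5)"
    using has_jet_diff[OF has_jet_add[OF has_jet_mult[OF x x] has_jet_mult[OF y y]] one]
  proof (rule has_jet_cong)
    show "(\<lambda>h. (norm (?u h))\<^sup>2 - 1 - (?u h $ 1 * ?u h $ 1 + ?u h $ 2 * ?u h $ 2 - 1))
        \<in> O[at_right 0](\<lambda>h. h ^ 6)"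
      by (simp add: power2_norm_eq_inner inner_vec_def sum_2)
    show "monom 1 6 dvd ?p * ?p + ?q * ?q - 1 - monom 36 5"
      unfolding monom_1_dvd_iff' all_less_6 by (simp add: coeff_pCons_numeral one_pCons)
  qed
  then have "\<forall>\<^sub>F h in at_right 0. (norm (?u h))\<^sup>2 - 1 > 0"
    using has_jet_eventually_pos[of 5 "\<lambda>h. (norm (?u h))\<^sup>2 - 1" 36] by simp
  then show ?thesis
    by simp
qed

lemma ssprk_scaleR: "ssprk_10_4 (\<lambda>u. c *\<^sub>R g u) dt u0 = ssprk_10_4 g (c * dt) u0"
  by (simp add: ssprk_10_4_def mult_ac)

theorem theorem4p3:
  fixes L :: real
  assumes "L > 0"
  shows "\<exists>g :: real^2 \<Rightarrow> real^2.
           smooth g \<and> semibounded g \<and> lip_seminorm g \<le> ennreal L \<and>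
           \<not> strongly_stable ssprk_10_4 g"
proof -
  obtain K where K: "K > 0" "\<And>u v. norm (swirl u - swirl v) \<le> K * norm (u - v)"
    using bounded_lipschitz_swirl by (rule bounded_lipschitzE) blast
  define c where "c = L / K"
  have c: "c > 0" "c * K = L"
    using assms K(1) by (simp_all add: c_def)
  let ?g = "\<lambda>u. c *\<^sub>R swirl u"
  have "smooth ?g"
    by (intro smooth_scaleR smooth_const smooth_swirl)
  moreover have "semibounded ?g"
    using semibounded_swirl c(1) by (simp add: semibounded_def mult_nonneg_nonpos)
  moreover have "lip_seminorm ?g \<le> ennreal L"
  proof (rule lip_seminorm_le)
    fix u v
    show "norm (?g u - ?g v) \<le> L * norm (u - v)"
      using mult_left_mono[OF K(2)[of u v], of c] c(1)
      by (simp add: flip: scaleR_diff_right c(2))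
  qed
  moreover have "\<not> strongly_stable ssprk_10_4 ?g"
  proof
    assume "strongly_stable ssprk_10_4 ?g"
    then obtain T where T: "T > 0"
      and stable: "\<And>u0 dt. 0 < dt \<Longrightarrow> dt \<le> T \<Longrightarrow> (norm (ssprk_10_4 ?g dt u0))\<^sup>2 \<le> (norm u0)\<^sup>2"
      by (auto simp: strongly_stable_def)
    have "\<forall>\<^sub>F h in at_right 0. h \<in> {0<..<c * T / 6}"
      using c T by (intro eventually_at_right_real) simp
    from eventually_conj[OF this ssprk_energy_increase]
    obtain h where h: "0 < h" "h < c * T / 6"
      and energy: "(norm (ssprk_10_4 swirl (6 * h) (axis 1 1)))\<^sup>2 > 1"
      by (auto dest!: eventually_happens simp: trivial_limit_at_right_real)
    have "(norm (ssprk_10_4 ?g (6 * h / c) (axis 1 1)))\<^sup>2 \<le> (norm (axis 1 1 :: real^2))\<^sup>2"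
      using h c by (intro stable) (simp_all add: field_simps)
    with energy c show False
      by (simp add: ssprk_scaleR norm_axis_1)
  qed
  ultimately show ?thesis
    by blast
qed

end
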